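(* Let $n\ge 1$, let $y_1,\dots,y_n\in\mathbb{R}$, put $r_0=0$ and $r_i=\sum_{k=1}^i y_k$ for $1\le i\le n$, let $\lambda_1,\dots,\lambda_{n-1}>0$ and put $\lambda_0=\lambda_n=0$. Consider the tube with bottom $\ell_i=r_i-\lambda_i$ and ceiling $u_i=r_i+\lambda_i$, $0\le i\le n$. Then replacing the smallest concave majorant (of the tube bottom) and the greatest convex minorant (of the tube ceiling) by the smallest affine majorant and the greatest affine minorant does not change the solution of the taut-string method: the linearized taut-string method and the classic taut-string method, both defined in the context, output the same string $(s_0,s_1,\dots,s_n)$ when run on this tube.
   Context: Majorants and minorants. Let $(a,c)$ be a point with $a\in\{0,\dots,n-1\}$, $c\in\mathbb{R}$ (the current segment start), and let $i\in\{a+1,\dots,n\}$. The majorants and minorants defined in the following list are functions on $[a,i]$ and take the value $c$ at $a$. - The smallest concave majorant of the tube bottom is the smallest concave function $g$ with $g(a)=c$ and $g(j)\ge \ell_j$ for all integers $a<j\le i$ and with $g(i)=\ell_i$ permitted, i.e. the upper boundary (as a piecewise linear function on $[a,i]$) of the convex hull of $(a,c)$ and the points $(j,\ell_j)$, $a<j\le i$. - The greatest convex minorant of the tube ceiling is the lower boundary of the convex hull of $(a,c)$ and the points $(j,u_j)$, $a<j\le i$. - The smallest affine majorant of the tube bottom is the affine function through $(a,c)$ with slope $\max_{a<j\le i}(\ell_j-c)/(j-a)$. - The greatest affine minorant of the tube ceiling is the affine function through $(a,c)$ with slope $\min_{a<j\le i}(u_j-c)/(j-a)$. The left-most segment of the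 concave majorant (convex minorant) is its first maximal linear piece, starting at $(a,c)$ and ending at a point $(j,\ell_j)$ (respectively $(j,u_j)$). For the affine majorant (minorant), the left-most segment is the part from $(a,c)$ to its last touching point with the tube, i.e. the point $(j,\ell_j)$ with the largest $j\in\{a+1,\dots,i\}$ attaining the maximum $\max_{a<j\le i}(\ell_j-c)/(j-a)$ (respectively the point $(j,u_j)$ with the largest $j\in\{a+1,\dots,i\}$ attaining the minimum $\min_{a<j\le i}(u_j-c)/(j-a)$). A crossing (overlap) is said to occur at $i$ if the slope of the left-most segment of the majorant is strictly greater than the slope of the left-most segment of the minorant. When a crossing occurs, the break point is the left-most of the two right endpoints of the left-most segments of the majorant and of the minorant. Classic taut-string method. Start with $(a,c)=(0,0)$ and $i=1$. Repeat: compute the smallest concave majorant of the bottom and the greatest convex minorant of the ceiling from $(a,c)$ over $\{a+1,\dots,i\}$. If a crossing occurs at $i$, append to the output the left-most segment (of the majorant or of the minorant) that ends at the break point, replace $(a,c)$ by the break point, keep $i$ unchanged, and repeat. If no crossing occurs and $i<n$, increase $i$ by one and repeat. If no crossing occurs and $i=n$, append the straight segment from $(a,c)$ to $(n,r_n)$ and stop. Linearized taut-string method. Start with $(a,c)=(0,0)$ and $i=1$. Repeat: compute the smallest affine majorant of the bottom and the greatest affine minorant of the ceiling from $(a,c)$ over $\{a+1,\dots,i\}$. If a crossing occurs at $i$, append to the output the left-most segment that ends at the break point, replace $(a,c)$ by the break point, discard all other information and restart with $i=a+1$ (for the new $a$). If no crossing occurs and $i<n$, increase $i$ by one and repeat.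 If no crossing occurs and $i=n$, append the straight segment from $(a,c)$ to $(n,r_n)$ and stop. In both methods the output string is $(s_0,\dots,s_n)$, where $s_j$ is the height at abscissa $j$ of the polyline formed by concatenating the appended segments. *)

theory Defs
  imports "HOL-Analysis.Analysis"
begin

text \<open>
  Throughout, a point is a pair of an integer abscissa and a real height, \<open>p = (a, c)\<close> is the
  current segment start and \<open>i > a\<close> is the current right end of the window \<open>[a, i]\<close>. The sequences
  \<open>l\<close> and \<open>u\<close> are the bottom and the ceiling of the tube.
\<close>

type_synonym point = "nat \<times> real"
type_synonym segment = "point \<times> point"

definition window_hull :: "(nat \<Rightarrow> real) \<Rightarrow> point \<Rightarrow> nat \<Rightarrow> (real \<times> real) set" where
  "window_hull f p i =
     convex hull (insert (real (fst p), snd p) ((\<lambda>j. (real j, f j)) ` {fst p<..i}))"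

definition concave_majorant :: "(nat \<Rightarrow> real) \<Rightarrow> point \<Rightarrow> nat \<Rightarrow> real \<Rightarrow> real" where
  "concave_majorant l p i x = Sup {y. (x, y) \<in> window_hull l p i}"

definition convex_minorant :: "(nat \<Rightarrow> real) \<Rightarrow> point \<Rightarrow> nat \<Rightarrow> real \<Rightarrow> real" where
  "convex_minorant u p i x = Inf {y. (x, y) \<in> window_hull u p i}"

text \<open>
  The functions above are piecewise linear on \<open>[a, i]\<close> with all kinks at integers, so the first
  maximal linear piece is \<open>[a, j]\<close> for the largest integer \<open>j \<le> i\<close> such that the function is
  affine on \<open>[a, j]\<close>.
\<close>

definition first_piece_end :: "(real \<Rightarrow> real) \<Rightarrow> nat \<Rightarrow> nat \<Rightarrow> nat" where
  "first_piece_end g a i =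
     Max {j \<in> {a<..i}. \<exists>m k. \<forall>x\<in>{real a..real j}. g x = m * x + k}"

text \<open>
  A left-most segment starts at \<open>p\<close>; it is represented by its right endpoint.
\<close>

definition concave_majorant_seg :: "(nat \<Rightarrow> real) \<Rightarrow> point \<Rightarrow> nat \<Rightarrow> point" where
  "concave_majorant_seg l p i =
     (let g = concave_majorant l p i; j = first_piece_end g (fst p) i in (j, g (real j)))"

definition convex_minorant_seg :: "(nat \<Rightarrow> real) \<Rightarrow> point \<Rightarrow> nat \<Rightarrow> point" where
  "convex_minorant_seg u p i =
     (let g = convex_minorant u p i; j = first_piece_end g (fst p) i in (j, g (real j)))"

definition slope :: "point \<Rightarrow> point \<Rightarrow> real" where
  "slope p q = (snd q - snd p) / (real (fst q) - real (fst p))"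

definition affine_through :: "point \<Rightarrow> real \<Rightarrow> real \<Rightarrow> real" where
  "affine_through p m x = snd p + m * (x - real (fst p))"

definition affine_majorant :: "(nat \<Rightarrow> real) \<Rightarrow> point \<Rightarrow> nat \<Rightarrow> real \<Rightarrow> real" where
  "affine_majorant l p i = affine_through p (Max ((\<lambda>j. slope p (j, l j)) ` {fst p<..i}))"

definition affine_minorant :: "(nat \<Rightarrow> real) \<Rightarrow> point \<Rightarrow> nat \<Rightarrow> real \<Rightarrow> real" where
  "affine_minorant u p i = affine_through p (Min ((\<lambda>j. slope p (j, u j)) ` {fst p<..i}))"

definition affine_majorant_seg :: "(nat \<Rightarrow> real) \<Rightarrow> point \<Rightarrow> nat \<Rightarrow> point" where
  "affine_majorant_seg l p i =
     (let j = Max {j \<in> {fst p<..i}. affine_majorant l p i (real j) = l j} in (j, l j))"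

definition affine_minorant_seg :: "(nat \<Rightarrow> real) \<Rightarrow> point \<Rightarrow> nat \<Rightarrow> point" where
  "affine_minorant_seg u p i =
     (let j = Max {j \<in> {fst p<..i}. affine_minorant u p i (real j) = u j} in (j, u j))"

text \<open>
  \<open>P\<close> and \<open>Q\<close> are the right endpoints of the left-most segments of the majorant and of the
  minorant. When \<open>l \<le> u\<close> and there is a crossing, their abscissae differ.
\<close>

definition crossing :: "point \<Rightarrow> point \<Rightarrow> point \<Rightarrow> bool" where
  "crossing p P Q \<longleftrightarrow> slope p P > slope p Q"

definition break_point :: "point \<Rightarrow> point \<Rightarrow> point" where
  "break_point P Q = (if fst P \<le> fst Q then P else Q)"

text \<open>
  The two iterations, with loop state \<open>(out, p, i)\<close>, where \<open>out\<close> is the list of segments output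
  so far and \<open>h\<close> is the height of the final point of the string. A result \<open>Some segs\<close> means that
  the iteration terminates with output \<open>segs\<close>, and \<open>None\<close> means that it runs forever.
\<close>

partial_function (option) classic_loop ::
  "nat \<Rightarrow> (nat \<Rightarrow> real) \<Rightarrow> (nat \<Rightarrow> real) \<Rightarrow> real \<Rightarrow> segment list \<Rightarrow> point \<Rightarrow> nat \<Rightarrow> segment list option"
where
  "classic_loop n l u h out p i =
     (let P = concave_majorant_seg l p i; Q = convex_minorant_seg u p i; b = break_point P Q
      in if crossing p P Q then classic_loop n l u h (out @ [(p, b)]) b i
         else if i < n then classic_loop n l u h out p (i + 1)
         else Some (out @ [(p, (n, h))]))"

partial_function (option) linearized_loop ::
  "nat \<Rightarrow> (nat \<Rightarrow> real) \<Rightarrow> (nat \<Rightarrow> real) \<Rightarrow> real \<Rightarrow> segment list \<Rightarrow> point \<Rightarrow> nat \<Rightarrow> segment list option"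
where
  "linearized_loop n l u h out p i =
     (let P = affine_majorant_seg l p i; Q = affine_minorant_seg u p i; b = break_point P Q
      in if crossing p P Q then linearized_loop n l u h (out @ [(p, b)]) b (fst b + 1)
         else if i < n then linearized_loop n l u h out p (i + 1)
         else Some (out @ [(p, (n, h))]))"

text \<open>
  Height at abscissa \<open>j\<close> of a polyline given by its consecutive segments from left to right.
\<close>

fun polyline_height :: "segment list \<Rightarrow> nat \<Rightarrow> real" where
  "polyline_height [] j = undefined"
| "polyline_height ((p, q) # segs) j =
     (if j \<le> fst q then affine_through p (slope p q) (real j) else polyline_height segs j)"

definition string_of :: "nat \<Rightarrow> segment list \<Rightarrow> real list" where
  "string_of n segs = map (polyline_height segs) [0..<n + 1]"

definition classic_taut_string ::
  "nat \<Rightarrow> (nat \<Rightarrow> real) \<Rightarrow> (nat \<Rightarrow> real) \<Rightarrow> real \<Rightarrow> real list option" where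
  "classic_taut_string n l u h = map_option (string_of n) (classic_loop n l u h [] (0, 0) 1)"

definition linearized_taut_string ::
  "nat \<Rightarrow> (nat \<Rightarrow> real) \<Rightarrow> (nat \<Rightarrow> real) \<Rightarrow> real \<Rightarrow> real list option" where
  "linearized_taut_string n l u h = map_option (string_of n) (linearized_loop n l u h [] (0, 0) 1)"

end

theory Submission
  imports Defs
begin

text \<open>
  The first piece of the concave majorant is the steepest chord from the start point to the tube
  bottom, prolonged to the last point where it touches, and hence equals the left-most segment of
  the affine majorant; dually for the minorants. So both methods find the same crossings and
  break points, and differ only in that the linearized method restarts right after the break point.
  That makes no difference: if the first crossing from \<open>p\<close> occurs at \<open>i\<close>, then the line through
  \<open>p\<close> and the break point \<open>b\<close> stays inside the tube up to \<open>i - 1\<close>, so it witnesses that no crossing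
  from \<open>b\<close> occurs before \<open>i\<close>.
\<close>

text \<open>Reflection in the horizontal axis turns a ceiling \<open>u\<close> into the bottom
  \<open>\<lambda>j. - u j\<close> and minorants into majorants, so each geometric fact is proved
  for majorants only and then transferred.\<close>

definition reflect :: "point \<Rightarrow> point" where
  "reflect p = (fst p, - snd p)"

lemma fst_reflect [simp]: "fst (reflect p) = fst p"
  by (simp add: reflect_def)

lemma snd_reflect [simp]: "snd (reflect p) = - snd p"
  by (simp add: reflect_def)

lemma slope_reflect: "slope (reflect p) (j, - y) = - slope p (j, y)"
  by (simp add: slope_def minus_divide_left)

subsection \<open>Left-most segments of the affine majorant and minorant\<close>

lemma affine_through_slope_eq_iff:
  assumes "fst p < j"
  shows "affine_through p m (real j) = y \<longleftrightarrow> slope p (j, y) = m"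
  using assms by (auto simp: affine_through_def slope_def field_simps)

text \<open>Touching the majorant at \<open>j\<close> means attaining the maximal slope, so taking
  the last touching point makes the inequality strict beyond \<open>j\<close>. This strictness later
  locates the first kink of the concave majorant.\<close>

lemma affine_majorant_segE:
  assumes "fst p < i"
  obtains j where "affine_majorant_seg l p i = (j, l j)" and "fst p < j" and "j \<le> i"
    and "\<And>k. fst p < k \<Longrightarrow> k \<le> i \<Longrightarrow> slope p (k, l k) \<le> slope p (j, l j)"
    and "\<And>k. j < k \<Longrightarrow> k \<le> i \<Longrightarrow> slope p (k, l k) < slope p (j, l j)"
proof -
  let ?s = "\<lambda>j. slope p (j, l j)"
  define M where "M = Max (?s ` {fst p<..i})"
  define T where "T = {j \<in> {fst p<..i}. affine_majorant l p i (real j) = l j}"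
  have T: "T = {j \<in> {fst p<..i}. ?s j = M}"
    by (auto simp: T_def M_def affine_majorant_def affine_through_slope_eq_iff)
  have ne: "{fst p<..i} \<noteq> {}" using assms by auto
  then have "M \<in> ?s ` {fst p<..i}" unfolding M_def by (intro Max_in) auto
  then have "T \<noteq> {}" unfolding T by auto
  moreover have finT: "finite T" by (simp add: T_def)
  ultimately have MT: "Max T \<in> T" by (rule Max_in[rotated])
  have le: "?s k \<le> M" if "fst p < k" "k \<le> i" for k
    using that unfolding M_def by (intro Max_ge) auto
  show ?thesis
  proof (rule that[of "Max T"])
    show "affine_majorant_seg l p i = (Max T, l (Max T))"
      by (simp add: affine_majorant_seg_def T_def Let_def)
    show "fst p < Max T" "Max T \<le> i" using MT unfolding T by auto
    show "?s k \<le> ?s (Max T)" if "fst p < k" "k \<le> i" for k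
      using MT le[OF that] unfolding T by auto
    show "?s k < ?s (Max T)" if "Max T < k" "k \<le> i" for k
    proof -
      have "fst p < k" using MT that unfolding T by auto
      moreover have "k \<notin> T" using Max_ge[OF finT] that(1) by (meson leD)
      ultimately show ?thesis using le[of k] that(2) MT unfolding T by force
    qed
  qed
qed

lemma affine_minorant_reflect:
  assumes "fst p < i"
  shows "affine_majorant (\<lambda>j. - u j) (reflect p) i x = - affine_minorant u p i x"
proof -
  let ?S = "(\<lambda>j. slope p (j, u j)) ` {fst p<..i}"
  have "Max (uminus ` ?S) = - Min ?S"
    using assms by (intro minus_Min_eq_Max[symmetric]) auto
  then show ?thesis
    by (simp add: affine_majorant_def affine_minorant_def slope_reflect image_image
        affine_through_def)
qed

lemma affine_minorant_seg_reflect: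
  assumes "fst p < i"
  shows "affine_minorant_seg u p i = reflect (affine_majorant_seg (\<lambda>j. - u j) (reflect p) i)"
  by (simp add: affine_majorant_seg_def affine_minorant_seg_def affine_minorant_reflect[OF assms]
      Let_def reflect_def[of "(_, _)"])

lemma affine_minorant_segE:
  assumes "fst p < i"
  obtains j where "affine_minorant_seg u p i = (j, u j)" and "fst p < j" and "j \<le> i"
    and "\<And>k. fst p < k \<Longrightarrow> k \<le> i \<Longrightarrow> slope p (j, u j) \<le> slope p (k, u k)"
    and "\<And>k. j < k \<Longrightarrow> k \<le> i \<Longrightarrow> slope p (j, u j) < slope p (k, u k)"
proof -
  have "fst (reflect p) < i" using assms by simp
  from affine_majorant_segE[OF this, of "\<lambda>j. - u j"] obtain j where
    "affine_majorant_seg (\<lambda>j. - u j) (reflect p) i = (j, - u j)" "fst p < j" "j \<le> i"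
    "\<And>k. fst p < k \<Longrightarrow> k \<le> i \<Longrightarrow> slope p (j, u j) \<le> slope p (k, u k)"
    "\<And>k. j < k \<Longrightarrow> k \<le> i \<Longrightarrow> slope p (j, u j) < slope p (k, u k)"
    by (auto simp: slope_reflect)
  then show ?thesis
    using that by (simp add: affine_minorant_seg_reflect[OF assms] reflect_def)
qed

subsection \<open>Left-most segments of the concave majorant and convex minorant\<close>

text \<open>The line \<open>L\<close> from \<open>p\<close> of maximal slope bounds the hull from
  above. Up to \<open>J\<close> it is a chord of the hull, so the majorant equals \<open>L\<close>
  there; beyond \<open>J\<close> the majorant stays strictly below \<open>L\<close>.\<close>

lemma concave_majorant_seg_eq_affine:
  assumes "fst p < i"
  shows "concave_majorant_seg l p i = affine_majorant_seg l p i"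
proof -
  obtain a c where p: "p = (a, c)" by (cases p)
  obtain J where seg: "affine_majorant_seg l p i = (J, l J)" and J: "a < J" "J \<le> i"
    and le: "\<And>k. a < k \<Longrightarrow> k \<le> i \<Longrightarrow> slope p (k, l k) \<le> slope p (J, l J)"
    and less: "\<And>k. J < k \<Longrightarrow> k \<le> i \<Longrightarrow> slope p (k, l k) < slope p (J, l J)"
    using affine_majorant_segE[OF assms, of l] unfolding p by auto
  define g where "g = concave_majorant l p i"
  define M where "M = slope p (J, l J)"
  define L where "L x = c + M * (x - real a)" for x
  define V where "V = insert (real a, c) ((\<lambda>j. (real j, l j)) ` {a<..i})"
  have hull: "window_hull l p i = convex hull V" by (simp add: window_hull_def V_def p)
  have LJ: "L (real J) = l J" using J by (simp add: L_def M_def slope_def p)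
  have lL: "l k \<le> L (real k)" if "a < k" "k \<le> i" for k
    using le[OF that, folded M_def] that(1) by (simp add: L_def slope_def p divide_le_eq algebra_simps)
  have lL': "l k < L (real k)" if "J < k" "k \<le> i" for k
    using less[OF that, folded M_def] that(1) J(1)
    by (simp add: L_def slope_def p divide_less_eq algebra_simps)

  have below: "y \<le> L x" if "(x, y) \<in> convex hull V" for x y
  proof -
    \<comment> \<open>The closed half-plane below \<open>L\<close>, in inner-product form: it is
      convex, so it contains the hull once it contains the generators.\<close>
    define H where "H = {z :: real \<times> real. inner (- M, 1) z \<le> c - M * real a}"
    have "convex H" unfolding H_def by (rule convex_halfspace_le)
    moreover have "V \<subseteq> H"
      using lL by (auto simp: V_def H_def L_def algebra_simps)
    ultimately have "convex hull V \<subseteq> H" by (rule hull_minimal[rotated])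
    then show ?thesis using that by (auto simp: H_def L_def algebra_simps)
  qed
  \<comment> \<open>Tilting the line about \<open>(J, l J)\<close> by a small slope \<open>d\<close> keeps it above the hull,
    so the majorant leaves the original line right of \<open>J\<close>.\<close>
  obtain d where d: "d > 0" "\<And>k. J < k \<Longrightarrow> k \<le> i \<Longrightarrow> l k \<le> L (real k) - d * (real k - real J)"
  proof (cases "J < i")
    case True
    \<comment> \<open>\<open>q k\<close> is the largest tilt that still leaves
      \<open>(k, l k)\<close> below the line; finitely many such positive bounds have a positive
      minimum.\<close>
    define q where "q k = (L (real k) - l k) / (real k - real J)" for k
    define d where "d = Min (q ` {J<..i})"
    have "d \<in> q ` {J<..i}" unfolding d_def using True by (intro Min_in) auto
    then have "d > 0" using lL' by (auto simp: q_def)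
    moreover have "l k \<le> L (real k) - d * (real k - real J)" if "J < k" "k \<le> i" for k
    proof -
      have "d \<le> q k" unfolding d_def using that by (intro Min_le) auto
      then show ?thesis using that by (simp add: q_def field_simps)
    qed
    ultimately show ?thesis using that by blast
  next
    case False
    then show ?thesis using that[of 1] by auto
  qed
  have strictly_below: "y \<le> L x - d * (x - real J)" if "(x, y) \<in> convex hull V" for x y
  proof -
    define H where
      "H = {z :: real \<times> real. inner (d - M, 1) z \<le> c - M * real a + d * real J}"
    have "convex H" unfolding H_def by (rule convex_halfspace_le)
    moreover have "V \<subseteq> H"
    proof -
      have "l k \<le> L (real k) - d * (real k - real J)" if "a < k" "k \<le> i" for k
      proof (cases "J < k")
        \<comment> \<open>Left of \<open>J\<close> the tilt only raises the line.\<close>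
        case False
        then have "d * (real k - real J) \<le> 0" using d(1) by (simp add: mult_le_0_iff)
        then show ?thesis using lL[OF that] by linarith
      qed (use d(2) that in auto)
      moreover have "d * real a \<le> d * real J" using d(1) J by simp
      ultimately show ?thesis
        by (auto simp: V_def H_def L_def algebra_simps)
    qed
    ultimately have "convex hull V \<subseteq> H" by (rule hull_minimal[rotated])
    then show ?thesis using that by (auto simp: H_def L_def algebra_simps)
  qed

  have gL: "g x = L x" if "real a \<le> x" "x \<le> real J" for x
  proof -
    have "(x, L x) \<in> closed_segment (real a, c) (real J, l J)"
    proof -
      define t where "t = (x - real a) / (real J - real a)"
      have t: "0 \<le> t" "t \<le> 1" "x = real a + t * (real J - real a)"
        using that J by (auto simp: t_def)
      have "L (real a + t * (real J - real a)) = (1 - t) * c + t * L (real J)"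
        by (simp add: L_def algebra_simps)
      then have "L x = (1 - t) * c + t * l J" unfolding t(3)[symmetric] LJ .
      moreover have "x = (1 - t) * real a + t * real J" using t(3) by (simp add: algebra_simps)
      ultimately have "(x, L x) = (1 - t) *\<^sub>R (real a, c) + t *\<^sub>R (real J, l J)"
        unfolding scaleR_Pair add_Pair real_scaleR_def prod.inject by blast
      then show ?thesis using t(1,2) unfolding in_segment by blast
    qed
    moreover have "closed_segment (real a, c) (real J, l J) \<subseteq> convex hull V"
      using J by (intro closed_segment_subset) (auto simp: V_def intro!: hull_inc)
    \<comment> \<open>By \<open>below\<close>, \<open>L x\<close> is then the maximum of the
      vertical slice of the hull at \<open>x\<close>, so the supremum is attained.\<close>
    ultimately have "(x, L x) \<in> convex hull V" by blast
    then show ?thesis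
      unfolding g_def concave_majorant_def hull using below by (intro cSup_eq_maximum) auto
  qed
  have gless: "g (real k) < L (real k)" if "J < k" "k \<le> i" for k
  proof -
    \<comment> \<open>This makes the slice at \<open>k\<close> nonempty, so that its supremum
      inherits the upper bound.\<close>
    have "(real k, l k) \<in> convex hull V" using that J by (auto simp: V_def intro!: hull_inc)
    then have "g (real k) \<le> L (real k) - d * (real k - real J)"
      unfolding g_def concave_majorant_def hull using strictly_below by (intro cSup_least) auto
    moreover have "d * (real k - real J) > 0" using d(1) that by simp
    ultimately show ?thesis by linarith
  qed

  have "first_piece_end g a i = J"
    unfolding first_piece_end_def
  proof (rule Max_eqI)
    have "\<forall>x\<in>{real a..real J}. g x = M * x + (c - M * real a)"
      using gL by (auto simp: L_def algebra_simps)
    then have "\<exists>m k. \<forall>x\<in>{real a..real J}. g x = m * x + k" by (intro exI)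
    then show "J \<in> {j \<in> {a<..i}. \<exists>m k. \<forall>x\<in>{real a..real j}. g x = m * x + k}"
      using J by simp
  next
    fix j assume "j \<in> {j \<in> {a<..i}. \<exists>m k. \<forall>x\<in>{real a..real j}. g x = m * x + k}"
    then obtain m k where j: "a < j" "j \<le> i"
      and aff: "\<And>x. real a \<le> x \<Longrightarrow> x \<le> real j \<Longrightarrow> g x = m * x + k" by auto
    show "j \<le> J"
    proof (rule ccontr)
      assume "\<not> j \<le> J"
      \<comment> \<open>An affine piece reaching past \<open>J\<close> would agree with
        \<open>L\<close> at the two points \<open>a\<close> and \<open>J\<close>, hence equal
        \<open>L\<close> up to \<open>j\<close>, against \<open>gless\<close>.\<close>
      then have *: "L (real a) = m * real a + k" "L (real J) = m * real J + k"
        using aff gL J by (force simp flip: gL)+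
      then have "m * (real J - real a) = M * (real J - real a)"
        by (simp add: L_def algebra_simps)
      then have "m = M" using J by simp
      then have "L (real j) = m * real j + k" using * by (simp add: L_def algebra_simps)
      then show False using aff[of "real j"] gless[of j] j \<open>\<not> j \<le> J\<close> by simp
    qed
  qed simp
  \<comment> \<open>The concave segment takes its end height from the majorant, the affine one from
    the tube.\<close>
  moreover have "g (real J) = l J" using gL J LJ by simp
  ultimately show ?thesis
    by (simp add: concave_majorant_seg_def Let_def seg flip: g_def) (simp add: p)
qed

text \<open>Reflection is linear and so commutes with convex hulls.\<close>

lemma window_hull_reflect:
  "window_hull (\<lambda>j. - f j) (reflect p) i = (\<lambda>(x, y). (x, - y)) ` window_hull f p i"
proof -
  have "linear (\<lambda>(x :: real, y :: real). (x, - y))"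
    by (intro linearI) auto
  then show ?thesis
    unfolding window_hull_def
    by (subst convex_hull_linear_image) (simp_all add: image_image)
qed

lemma convex_minorant_reflect:
  "concave_majorant (\<lambda>j. - u j) (reflect p) i = (\<lambda>x. - convex_minorant u p i x)"
proof
  fix x
  have "{y. (x, y) \<in> window_hull (\<lambda>j. - u j) (reflect p) i} =
      uminus ` {y. (x, y) \<in> window_hull u p i}"
    by (auto simp: window_hull_reflect image_iff) force
  then show "concave_majorant (\<lambda>j. - u j) (reflect p) i x = - convex_minorant u p i x"
    by (simp add: concave_majorant_def convex_minorant_def Inf_real_def)
qed

lemma first_piece_end_uminus: "first_piece_end (\<lambda>x. - g x) a i = first_piece_end g a i"
proof -
  have *: "\<exists>m k. \<forall>x\<in>S. - h x = m * x + k"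
    if "\<exists>m k. \<forall>x\<in>S. h x = m * x + k" for h :: "real \<Rightarrow> real" and S
  proof -
    from that obtain m k where "\<forall>x\<in>S. h x = m * x + k" by blast
    then have "\<forall>x\<in>S. - h x = (- m) * x + (- k)" by simp
    then show ?thesis by blast
  qed
  have "(\<exists>m k. \<forall>x\<in>S. - g x = m * x + k) \<longleftrightarrow> (\<exists>m k. \<forall>x\<in>S. g x = m * x + k)" for S
    using *[of S g] *[of S "\<lambda>x. - g x"] by auto
  then show ?thesis by (simp add: first_piece_end_def)
qed

lemma convex_minorant_seg_eq_affine:
  assumes "fst p < i"
  shows "convex_minorant_seg u p i = affine_minorant_seg u p i"
proof -
  have "convex_minorant_seg u p i = reflect (concave_majorant_seg (\<lambda>j. - u j) (reflect p) i)"
    by (simp add: concave_majorant_seg_def convex_minorant_seg_def Let_def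
        convex_minorant_reflect first_piece_end_uminus reflect_def[of "(_, _)"])
  then show ?thesis
    using assms by (simp add: concave_majorant_seg_eq_affine affine_minorant_seg_reflect)
qed

subsection \<open>Crossings\<close>

abbreviation crossing_at :: "(nat \<Rightarrow> real) \<Rightarrow> (nat \<Rightarrow> real) \<Rightarrow> point \<Rightarrow> nat \<Rightarrow> bool" where
  "crossing_at l u p i \<equiv> crossing p (affine_majorant_seg l p i) (affine_minorant_seg u p i)"

abbreviation break_at :: "(nat \<Rightarrow> real) \<Rightarrow> (nat \<Rightarrow> real) \<Rightarrow> point \<Rightarrow> nat \<Rightarrow> point" where
  "break_at l u p i \<equiv> break_point (affine_majorant_seg l p i) (affine_minorant_seg u p i)"

text \<open>The two segments realise the largest bottom slope and the smallest ceiling slope, so a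
  crossing is a conflict between some pair of slopes. In this form the two end points no longer
  appear.\<close>

lemma crossing_at_iff:
  assumes "fst p < i"
  shows "crossing_at l u p i \<longleftrightarrow>
    (\<exists>j\<in>{fst p<..i}. \<exists>k\<in>{fst p<..i}. slope p (k, u k) < slope p (j, l j))"
proof -
  obtain J where J: "affine_majorant_seg l p i = (J, l J)" "fst p < J" "J \<le> i"
    "\<And>k. fst p < k \<Longrightarrow> k \<le> i \<Longrightarrow> slope p (k, l k) \<le> slope p (J, l J)"
    using affine_majorant_segE[OF assms, of l] by metis
  obtain K where K: "affine_minorant_seg u p i = (K, u K)" "fst p < K" "K \<le> i"
    "\<And>k. fst p < k \<Longrightarrow> k \<le> i \<Longrightarrow> slope p (K, u K) \<le> slope p (k, u k)"
    using affine_minorant_segE[OF assms, of u] by metis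
  show ?thesis
  proof
    assume "crossing_at l u p i"
    then have "slope p (K, u K) < slope p (J, l J)" by (simp add: crossing_def J(1) K(1))
    then show "\<exists>j\<in>{fst p<..i}. \<exists>k\<in>{fst p<..i}. slope p (k, u k) < slope p (j, l j)"
      using J(2,3) K(2,3) by (intro bexI[of _ J] bexI[of _ K]) auto
  next
    assume "\<exists>j\<in>{fst p<..i}. \<exists>k\<in>{fst p<..i}. slope p (k, u k) < slope p (j, l j)"
    then have "slope p (K, u K) < slope p (J, l J)" using J(4) K(4) by force
    then show "crossing_at l u p i" by (simp add: crossing_def J(1) K(1))
  qed
qed

text \<open>Either side of each equivalence says on which side of the line through \<open>p\<close>
  and \<open>b\<close> the point \<open>(k, z)\<close> lies.\<close>

lemma slope_from_chord:
  assumes "fst p < fst b" and "fst b < k"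
  shows "slope b (k, z) \<le> slope p b \<longleftrightarrow> slope p (k, z) \<le> slope p b"
    and "slope p b \<le> slope b (k, z) \<longleftrightarrow> slope p b \<le> slope p (k, z)"
proof -
  define s where "s = slope p b"
  have b: "snd b = snd p + s * (real (fst b) - real (fst p))"
    using assms by (simp add: s_def slope_def)
  show "slope b (k, z) \<le> slope p b \<longleftrightarrow> slope p (k, z) \<le> slope p b"
    and "slope p b \<le> slope b (k, z) \<longleftrightarrow> slope p b \<le> slope p (k, z)"
    unfolding s_def[symmetric] using assms
    by (simp_all add: slope_def b divide_le_eq le_divide_eq algebra_simps)
qed

text \<open>The prolonged chord separates bottom from ceiling on the window, so its slope lies
  between all bottom and all ceiling slopes seen from \<open>b\<close>. The hypotheses use slopes
  from \<open>p\<close>, where the absence of crossings is known.\<close>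

lemma no_crossing_from_chord:
  assumes "fst p < fst b" and "fst b < k"
    and "\<And>j. fst b < j \<Longrightarrow> j \<le> k \<Longrightarrow> slope p (j, l j) \<le> slope p b"
    and "\<And>j. fst b < j \<Longrightarrow> j \<le> k \<Longrightarrow> slope p b \<le> slope p (j, u j)"
  shows "\<not> crossing_at l u b k"
proof -
  have "slope b (j, l j) \<le> slope b (j', u j')" if "j \<in> {fst b<..k}" "j' \<in> {fst b<..k}" for j j'
  proof -
    have "slope b (j, l j) \<le> slope p b"
      using that assms(3) slope_from_chord(1)[OF assms(1)] by simp
    also have "\<dots> \<le> slope b (j', u j')"
      using that assms(4) slope_from_chord(2)[OF assms(1)] by simp
    finally show ?thesis .
  qed
  then show ?thesis by (auto simp: crossing_at_iff[OF assms(2)] not_less)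
qed

text \<open>The chord from \<open>p\<close> to \<open>b\<close> has an extremal slope over the whole
  window, which handles one side of the tube. The other side follows because \<open>b\<close> is
  itself a tube point and no crossing from \<open>p\<close> occurs before \<open>i\<close>.\<close>

lemma break_at_crossing:
  assumes "fst p < i" and lu: "\<And>j. j \<le> i \<Longrightarrow> l j \<le> u j" and cr: "crossing_at l u p i"
    and nocr: "\<And>k. fst p < k \<Longrightarrow> k < i \<Longrightarrow> \<not> crossing_at l u p k"
  defines "b \<equiv> break_at l u p i"
  shows "fst p < fst b" and "fst b < i"
    and "\<And>k. fst b < k \<Longrightarrow> k < i \<Longrightarrow> \<not> crossing_at l u b k"
proof -
  obtain J where J: "affine_majorant_seg l p i = (J, l J)" "fst p < J" "J \<le> i"
    "\<And>k. fst p < k \<Longrightarrow> k \<le> i \<Longrightarrow> slope p (k, l k) \<le> slope p (J, l J)"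
    using affine_majorant_segE[OF assms(1), of l] by metis
  obtain K where K: "affine_minorant_seg u p i = (K, u K)" "fst p < K" "K \<le> i"
    "\<And>k. fst p < k \<Longrightarrow> k \<le> i \<Longrightarrow> slope p (K, u K) \<le> slope p (k, u k)"
    using affine_minorant_segE[OF assms(1), of u] by metis
  have KJ: "slope p (K, u K) < slope p (J, l J)"
    using cr by (simp add: crossing_def J(1) K(1))
  \<comment> \<open>A common abscissa would force the slopes into the order opposite to a crossing.
    Hence \<open>J\<close> and \<open>K\<close> differ, and the smaller one is below
    \<open>i\<close>.\<close>
  have "slope p (J, l J) \<le> slope p (J, u J)"
    using J(2) lu[OF J(3)] by (simp add: slope_def divide_right_mono)
  then have neq: "J \<noteq> K" using KJ by auto
  have b: "b = (if J < K then (J, l J) else (K, u K))"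
    using neq by (auto simp: b_def break_point_def J(1) K(1))
  show pb: "fst p < fst b" and bi: "fst b < i"
    using b neq J(2,3) K(2,3) by (auto split: if_splits)
  fix k assume k: "fst b < k" "k < i"
  have sep: "slope p (j, l j) \<le> slope p (j', u j')"
    if "fst p < j" "j \<le> k" "fst p < j'" "j' \<le> k" for j j'
    using nocr[of k] k pb that by (auto simp: crossing_at_iff not_less)
  show "\<not> crossing_at l u b k"
  proof (rule no_crossing_from_chord[OF pb k(1)])
    fix j assume j: "fst b < j" "j \<le> k"
    show "slope p (j, l j) \<le> slope p b"
    proof (cases "J < K")
      case True
      then show ?thesis using J(4)[of j] b pb j k by simp
    next
      case False
      \<comment> \<open>Here \<open>b = (K, u K)\<close> with \<open>K < k\<close>, so its slope is
        one of the ceiling slopes in \<open>sep\<close>.\<close>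
      then show ?thesis using sep[of j K] b pb j k by simp
    qed
    show "slope p b \<le> slope p (j, u j)"
    proof (cases "J < K")
      case True
      then show ?thesis using sep[of J j] b pb j k by simp
    next
      case False
      then show ?thesis using K(4)[of j] b pb j k by simp
    qed
  qed
qed

subsection \<open>The two iterations\<close>

lemma linearized_loop_skip:
  assumes "k \<le> i" and "i \<le> n" and "\<And>j. k \<le> j \<Longrightarrow> j < i \<Longrightarrow> \<not> crossing_at l u p j"
  shows "linearized_loop n l u h out p k = linearized_loop n l u h out p i"
  using assms
proof (induction k rule: inc_induct)
  case (step k)
  have "linearized_loop n l u h out p k = linearized_loop n l u h out p (Suc k)"
    using step.hyps step.prems by (subst linearized_loop.simps) (simp add: Let_def)
  also have "\<dots> = linearized_loop n l u h out p i"
    using step.IH step.prems by simp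
  finally show ?case .
qed simp

text \<open>The absence of crossings from \<open>p\<close> before \<open>i\<close> is the invariant
  under which the loops stay synchronised. Obtaining \<open>Some segs\<close> also gives termination
  of both.\<close>

lemma loops_agree:
  assumes "fst p < i" and "i \<le> n" and lu: "\<And>j. j \<le> n \<Longrightarrow> l j \<le> u j"
    and "\<And>k. fst p < k \<Longrightarrow> k < i \<Longrightarrow> \<not> crossing_at l u p k"
  shows "\<exists>segs. classic_loop n l u h out p i = Some segs \<and>
    linearized_loop n l u h out p i = Some segs"
  using assms(1,2,4)
\<comment> \<open>A break moves \<open>p\<close> to the right with \<open>i\<close> fixed; otherwise
  \<open>i\<close> grows with \<open>p\<close> fixed. Either way the measure drops.\<close>
proof (induction "(n - fst p) + (n - i)" arbitrary: out p i rule: less_induct)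
  case less
  let ?b = "break_at l u p i" and ?segs = "out @ [(p, break_at l u p i)]"
  note segs_eq = concave_majorant_seg_eq_affine[OF less.prems(1)]
    convex_minorant_seg_eq_affine[OF less.prems(1)]
  show ?case
  proof (cases "crossing_at l u p i")
    case True
    have "\<And>j. j \<le> i \<Longrightarrow> l j \<le> u j" using lu less.prems(2) by simp
    note b = break_at_crossing[OF less.prems(1) this True less.prems(3)]
    have "classic_loop n l u h out p i = classic_loop n l u h ?segs ?b i"
      using True by (subst classic_loop.simps) (simp add: Let_def segs_eq)
    moreover have "linearized_loop n l u h out p i = linearized_loop n l u h ?segs ?b i"
    proof -
      have "linearized_loop n l u h out p i = linearized_loop n l u h ?segs ?b (fst ?b + 1)"
        using True by (subst linearized_loop.simps) (simp add: Let_def)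
      \<comment> \<open>The restarted loop meets no crossing before \<open>i\<close>, so it catches
        up with the classic loop without output.\<close>
      also have "\<dots> = linearized_loop n l u h ?segs ?b i"
        using b(2,3) less.prems(2) by (intro linearized_loop_skip) auto
      finally show ?thesis .
    qed
    moreover have "(n - fst ?b) + (n - i) < (n - fst p) + (n - i)"
      using b(1,2) less.prems(2) by linarith
    note less.hyps[OF this b(2) less.prems(2) b(3)]
    ultimately show ?thesis by simp
  next
    case False
    show ?thesis
    proof (cases "i < n")
      case True
      have "(n - fst p) + (n - (i + 1)) < (n - fst p) + (n - i)" using True by linarith
      moreover have "\<not> crossing_at l u p k" if "fst p < k" "k < i + 1" for k
        using that False less.prems(3) by (cases "k = i") auto
      ultimately have "\<exists>segs. classic_loop n l u h out p (i + 1) = Some segs \<and>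
          linearized_loop n l u h out p (i + 1) = Some segs"
        using less.hyps[of p "i + 1" out] less.prems(1) True by simp
      moreover have "classic_loop n l u h out p i = classic_loop n l u h out p (i + 1)"
        using True False by (subst classic_loop.simps) (simp add: Let_def segs_eq)
      moreover have "linearized_loop n l u h out p i = linearized_loop n l u h out p (i + 1)"
        using True False by (subst linearized_loop.simps) (simp add: Let_def)
      ultimately show ?thesis by simp
    next
      case False': False
      have "classic_loop n l u h out p i = Some (out @ [(p, (n, h))])"
        using False False' by (subst classic_loop.simps) (simp add: Let_def segs_eq)
      moreover have "linearized_loop n l u h out p i = Some (out @ [(p, (n, h))])"
        using False False' by (subst linearized_loop.simps) (simp add: Let_def)
      ultimately show ?thesis by blast
    qed
  qed
qed

theorem propositionD1:
  fixes n :: nat and y r lam l u :: "nat \<Rightarrow> real"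
  assumes "n \<ge> 1"
    and "r 0 = 0"
    and "\<And>i. 1 \<le> i \<Longrightarrow> i \<le> n \<Longrightarrow> r i = (\<Sum>k=1..i. y k)"
    and "\<And>i. 1 \<le> i \<Longrightarrow> i \<le> n - 1 \<Longrightarrow> lam i > 0"
    and "lam 0 = 0" and "lam n = 0"
    and "\<And>i. i \<le> n \<Longrightarrow> l i = r i - lam i"
    and "\<And>i. i \<le> n \<Longrightarrow> u i = r i + lam i"
  shows "\<exists>s. classic_taut_string n l u (r n) = Some s \<and>
             linearized_taut_string n l u (r n) = Some s"
proof -
  have "l j \<le> u j" if "j \<le> n" for j
  proof -
    have "lam j \<ge> 0"
    proof (cases "j = 0 \<or> j = n")
      case True
      then show ?thesis using assms(5,6) by auto
    next
      case False
      then have "1 \<le> j" "j \<le> n - 1" using that by auto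
      then show ?thesis by (rule less_imp_le[OF assms(4)])
    qed
    then show ?thesis using assms(7,8) that by simp
  qed
  \<comment> \<open>Initially the invariant is vacuous: no integer lies strictly between 0 and
    1.\<close>
  then obtain segs where "classic_loop n l u (r n) [] (0, 0) 1 = Some segs"
    "linearized_loop n l u (r n) [] (0, 0) 1 = Some segs"
    using loops_agree[of "(0, 0)" 1 n l u "r n" "[]"] assms(1) by auto
  then show ?thesis
    by (simp add: classic_taut_string_def linearized_taut_string_def)
qed

end
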